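(* Let $p\ge1$ be an integer, let $K=u\left(\sum_{k=1}^p u_k-\sum_{k=1}^p u_{-k}\right)$, so that $u_t=K$ is the Narita-Itoh-Bogoyavlensky lattice, and let $$\Re=u\,(\mathcal S-\mathcal S^{-p})(\mathcal S-1)^{-1}\prod_{i=1}^{\rightarrow p}\left(\mathcal S^{p+1-i}u-u\mathcal S^{-i}\right)\left(\mathcal S^{p-i}u-u\mathcal S^{-i}\right)^{-1}$$ be its recursion operator. Then, starting from the equation itself, the symmetries $Q^l=\Re^l(K)$ of $u_t=K$ generated by $\Re$ are local, and for all integers $l\ge 0$ $$Q^l=\Re^l(K)=u\left(1-\mathcal S^{-(p+1)}\right)\mathcal S^{1-lp}\,\mathcal P^{(l+1,(l+1)p-1)} .$$
   Context: $u=u(n,t)$ with $n\in\mathbb Z$; $\mathcal S$ is the shift operator, $u_j=\mathcal S^j u$, $u_0=u$; the $u_j$ ($j\in\mathbb Z$) are treated as independent variables. In operators such as $\mathcal S^k u$, $u$ denotes multiplication by $u$ and juxtaposition is composition, so $\mathcal S^k u$ maps $f$ to $u_k\,\mathcal S^k(f)$. The ordered product is $\prod_{i=1}^{\rightarrow p}a_i=a_1a_2\cdots a_p$. For integers $l\ge1$, $k\ge0$ define the homogeneous difference polynomials $$\mathcal P^{(l,k)}=\sum_{0\le\lambda_{l-1}\le\cdots\le\lambda_0\le k}\ \prod_{j=0}^{l-1}u_{\lambda_j+jp}.$$ A function is local if it depends only on finitely many of the $u_j$. A (local) function $P$ is (the characteristic of) a symmetry of $u_t=K$ if $[K,P]=D_P[K]-D_K[P]=0$,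 where $D_P[Q]=\sum_j\frac{\partial P}{\partial u_j}\mathcal S^j(Q)$. Convention for applying $\Re$ to a difference polynomial: the factors of $\Re$ are applied successively from right to left, and for a factor $B^{-1}$, with $B=\mathcal S^{p-i}u-u\mathcal S^{-i}$ ($1\le i\le p$) or $B=\mathcal S-1$, $B^{-1}g$ denotes the difference polynomial $f$ (polynomial in the $u_j$) without constant term such that $Bf=g$; such $f$ is unique if it exists, and its existence at each step is part of the locality assertion. *)

theory Defs
  imports Complex_Main "HOL-Library.Poly_Mapping" "HOL-Library.FuncSet"
begin

section \<open>Difference polynomials\<close>

text \<open>
  Polynomials in the independent variables \<open>u\<^sub>j\<close>, \<open>j \<in> \<int>\<close>: a monomial is the finitely supported
  map sending \<open>j\<close> to the exponent of \<open>u\<^sub>j\<close>, and a polynomial is the finitely supported map sending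
  a monomial to its coefficient.  The product is the convolution product of
  \<^theory>\<open>HOL-Library.Poly_Mapping\<close>.  Every element involves only finitely many \<open>u\<^sub>j\<close>, so it is local.
\<close>

type_synonym 'a dpoly = "(int \<Rightarrow>\<^sub>0 nat) \<Rightarrow>\<^sub>0 'a"

definition u :: "int \<Rightarrow> 'a::field_char_0 dpoly" where
  "u j = Poly_Mapping.single (Poly_Mapping.single j 1) 1"

text \<open>The constant term is the coefficient of the empty monomial.\<close>

definition const_term :: "'a::field_char_0 dpoly \<Rightarrow> 'a" where
  "const_term P = Poly_Mapping.lookup P 0"

text \<open>\<open>shift k\<close> is \<open>\<S>\<^sup>k\<close>: the exponent of \<open>u\<^sub>j\<close> in the shifted monomial is that of \<open>u\<^bsub>j-k\<^esub>\<close> in the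
  original one.\<close>

definition shift_monom :: "int \<Rightarrow> (int \<Rightarrow>\<^sub>0 nat) \<Rightarrow> (int \<Rightarrow>\<^sub>0 nat)" where
  "shift_monom k m = Poly_Mapping.map_key (\<lambda>j. j - k) m"

definition shift :: "int \<Rightarrow> 'a::field_char_0 dpoly \<Rightarrow> 'a dpoly" where
  "shift k P = (\<Sum>m\<in>Poly_Mapping.keys P.
     Poly_Mapping.single (shift_monom k m) (Poly_Mapping.lookup P m))"

definition vars :: "'a::field_char_0 dpoly \<Rightarrow> int set" where
  "vars P = (\<Union>m\<in>Poly_Mapping.keys P. Poly_Mapping.keys m)"

text \<open>If \<open>u\<^sub>j\<close> does not occur in \<open>m\<close>, the truncated subtraction in the exponent is harmless because
  the coefficient is then \<open>0\<close>.\<close>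

definition pd :: "int \<Rightarrow> 'a::field_char_0 dpoly \<Rightarrow> 'a dpoly" where
  "pd j P = (\<Sum>m\<in>Poly_Mapping.keys P.
     Poly_Mapping.single (m - Poly_Mapping.single j 1)
       (of_nat (Poly_Mapping.lookup m j) * Poly_Mapping.lookup P m))"


section \<open>Symmetries\<close>

definition frechet :: "'a::field_char_0 dpoly \<Rightarrow> 'a dpoly \<Rightarrow> 'a dpoly" where
  "frechet P Q = (\<Sum>j\<in>vars P. pd j P * shift j Q)"

definition bracket :: "'a::field_char_0 dpoly \<Rightarrow> 'a dpoly \<Rightarrow> 'a dpoly" where
  "bracket K P = frechet P K - frechet K P"

definition is_symmetry :: "'a::field_char_0 dpoly \<Rightarrow> 'a dpoly \<Rightarrow> bool" where
  "is_symmetry K P \<longleftrightarrow> bracket K P = 0"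


section \<open>The Narita-Itoh-Bogoyavlensky lattice and its recursion operator\<close>

definition NIB :: "nat \<Rightarrow> 'a::field_char_0 dpoly" where
  "NIB p = u 0 * ((\<Sum>k=1..p. u (int k)) - (\<Sum>k=1..p. u (- int k)))"

text \<open>
  Operators that need not be defined everywhere are partial maps, with composition
  \<^term>\<open>(\<circ>\<^sub>m)\<close>, so that the right factor is applied first and an undefined intermediate step makes
  the result undefined.  The inverse of \<open>B\<close> is defined at \<open>g\<close> iff there is exactly one difference
  polynomial \<open>f\<close> without constant term such that \<open>B f = g\<close>.
\<close>

type_synonym 'a dop = "'a dpoly \<rightharpoonup> 'a dpoly"

definition total_op :: "('a::field_char_0 dpoly \<Rightarrow> 'a dpoly) \<Rightarrow> 'a dop" where
  "total_op B = (\<lambda>f. Some (B f))"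

definition inv_op :: "('a::field_char_0 dpoly \<Rightarrow> 'a dpoly) \<Rightarrow> 'a dop" where
  "inv_op B = (\<lambda>g. if \<exists>!f. const_term f = 0 \<and> B f = g
                   then Some (THE f. const_term f = 0 \<and> B f = g) else None)"

text \<open>\<open>two_term a i\<close> is the operator \<open>\<S>\<^sup>a u - u \<S>\<^sup>-\<^sup>i\<close>, where \<open>u\<close> is multiplication by \<open>u\<^sub>0\<close> and
  juxtaposition is composition.\<close>

definition two_term :: "int \<Rightarrow> int \<Rightarrow> 'a::field_char_0 dpoly \<Rightarrow> 'a dpoly" where
  "two_term a i f = shift a (u 0 * f) - u 0 * shift (- i) f"

definition rec_factor :: "nat \<Rightarrow> nat \<Rightarrow> 'a::field_char_0 dop" where
  "rec_factor p i =
     total_op (two_term (int p + 1 - int i) (int i)) \<circ>\<^sub>m inv_op (two_term (int p - int i) (int i))"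

definition ordered_prod :: "'a::field_char_0 dop list \<Rightarrow> 'a dop" where
  "ordered_prod As = foldr (\<circ>\<^sub>m) As Some"

definition rec_op :: "nat \<Rightarrow> 'a::field_char_0 dop" where
  "rec_op p =
     total_op (\<lambda>f. u 0 * (shift 1 f - shift (- int p) f))
     \<circ>\<^sub>m inv_op (\<lambda>f. shift 1 f - f)
     \<circ>\<^sub>m ordered_prod (map (rec_factor p) [1..<p+1])"

definition op_power :: "'a::field_char_0 dop \<Rightarrow> nat \<Rightarrow> 'a dop" where
  "op_power A l = ordered_prod (replicate l A)"


section \<open>The homogeneous difference polynomials\<close>

text \<open>The indices \<open>\<lambda>\<^sub>0 \<ge> \<dots> \<ge> \<lambda>\<^bsub>l-1\<^esub>\<close> in \<open>{0..k}\<close>, extended by \<^term>\<open>undefined\<close> outside \<open>{0..<l}\<close> so that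
  each tuple is counted once.\<close>

definition index_tuples :: "nat \<Rightarrow> nat \<Rightarrow> (nat \<Rightarrow> nat) set" where
  "index_tuples l k = {lam \<in> {0..<l} \<rightarrow>\<^sub>E {0..k}. antimono_on {0..<l} lam}"

definition hpoly :: "nat \<Rightarrow> nat \<Rightarrow> nat \<Rightarrow> 'a::field_char_0 dpoly" where
  "hpoly p l k = (\<Sum>lam\<in>index_tuples l k. \<Prod>j=0..<l. u (int (lam j + j * p)))"

end

theory Submission
  imports Defs
begin

text \<open>The lattice has the Lax operator \<open>L = \<S> + u \<S>\<^sup>-\<^sup>p\<close>, and \<open>K\<close> is the flow
  \<open>L\<^sub>t = [\<S>\<^bsup>p+1\<^esup> + a, L]\<close> with \<open>a = u\<^sub>0 + \<dots> + u\<^sub>p\<close>. All polynomials that occur are shifted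
  coefficients of powers of \<open>L\<close>. Comparing \<open>L\<^sup>n L\<close> with \<open>L L\<^sup>n\<close> gives two recursions for these
  coefficients. Each factor of the recursion operator turns one coefficient into the next by these
  two recursions alone, and the inverted operators are injective because they spread weights.
  If \<open>c\<close> and \<open>c'\<close> are the coefficients of \<open>\<S>\<^sup>0\<close> and \<open>\<S>\<^bsup>-(p+1)\<^esup>\<close> in the power \<open>(p + 1)(l + 1)\<close>, then
  \<open>Q\<^sup>l = u (1 - \<S>\<^sup>-\<^sup>p) c = (\<S> - 1) c'\<close>, while the Lax equation gives
  \<open>D\<^sub>c[K] = (\<S>\<^bsup>p+1\<^esup> - 1) c' = D\<^sub>a[Q\<^sup>l]\<close>; this makes the bracket of \<open>K\<close> and \<open>Q\<^sup>l\<close> vanish.\<close>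

section \<open>Calculus of difference polynomials\<close>

text \<open>Additive identities need only be checked on single terms: updating a coefficient outside
  the support amounts to adding a \<open>single\<close>.\<close>

lemma dpoly_induct [case_names single add]:
  fixes P :: "'a::field_char_0 dpoly \<Rightarrow> bool"
  assumes single: "\<And>m a. P (Poly_Mapping.single m a)"
    and add: "\<And>f g. P f \<Longrightarrow> P g \<Longrightarrow> P (f + g)"
  shows "P f"
proof (induction f rule: update_induct)
  case const
  show ?case using single[of 0 0] by simp
next
  case (update f a b)
  have "Poly_Mapping.update a b f = f + Poly_Mapping.single a b"
    using update(1)
    by (intro poly_mapping_eqI) (auto simp: lookup_update lookup_add lookup_single when_def in_keys_iff)
  then show ?case using add[OF update(3) single] by simp
qed

section \<open>Action of the shift on monomials and polynomials\<close>

lemma lookup_shift_monom [simp]: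
  "Poly_Mapping.lookup (shift_monom k m) j = Poly_Mapping.lookup m (j - k)"
  unfolding shift_monom_def by (subst map_key.rep_eq) (auto simp: inj_def)

lemma shift_monom_zero [simp]: "shift_monom k 0 = 0"
  by (rule poly_mapping_eqI) simp

lemma shift_monom_add: "shift_monom k (m + n) = shift_monom k m + shift_monom k n"
  by (rule poly_mapping_eqI) (simp add: lookup_add)

lemma shift_monom_diff: "shift_monom k (m - n) = shift_monom k m - shift_monom k n"
  by (rule poly_mapping_eqI) (simp add: lookup_minus)

lemma shift_monom_single: "shift_monom k (Poly_Mapping.single j a) = Poly_Mapping.single (j + k) a"
  by (rule poly_mapping_eqI) (auto simp: lookup_single when_def)

lemma shift_monom_shift_monom: "shift_monom k (shift_monom l m) = shift_monom (k + l) m"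
  by (rule poly_mapping_eqI) (simp add: algebra_simps)

lemma shift_monom_0 [simp]: "shift_monom 0 m = m"
  by (rule poly_mapping_eqI) simp

lemma inj_shift_monom: "inj (shift_monom k)"
  by (rule inj_on_inverseI[of _ "shift_monom (- k)"]) (simp add: shift_monom_shift_monom)

lemma keys_shift_monom: "Poly_Mapping.keys (shift_monom k m) = (\<lambda>j. j + k) ` Poly_Mapping.keys m"
proof (intro equalityI subsetI)
  fix j assume "j \<in> Poly_Mapping.keys (shift_monom k m)"
  then show "j \<in> (\<lambda>j. j + k) ` Poly_Mapping.keys m"
    by (intro image_eqI[of _ _ "j - k"]) (auto simp: in_keys_iff)
qed (auto simp: in_keys_iff)

lemma shift_single:
  "shift k (Poly_Mapping.single m a) = Poly_Mapping.single (shift_monom k m) (a::'a::field_char_0)"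
  by (simp add: shift_def)

lemma shift_add [simp]: "shift k (f + g) = shift k f + shift k g"
  unfolding shift_def by (rule setsum_keys_plus_distrib) (auto simp: single_add)

lemma shift_zero [simp]: "shift k 0 = 0"
  by (simp add: shift_def)

lemma shift_uminus [simp]: "shift k (- f) = - shift k f"
  using shift_add[of k "- f" f] by (simp add: eq_neg_iff_add_eq_0)

lemma shift_diff [simp]: "shift k (f - g) = shift k f - shift k g"
  using shift_add[of k f "- g"] by simp

lemma shift_sum [simp]: "shift k (sum f A) = (\<Sum>x\<in>A. shift k (f x))"
  by (induction A rule: infinite_finite_induct) auto

lemma shift_mult [simp]: "shift k (f * g) = shift k f * shift k g"
proof (induction f rule: dpoly_induct)
  case (single m a)
  show ?case
    by (induction g rule: dpoly_induct)
      (auto simp: mult_single shift_single shift_monom_add algebra_simps)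
qed (simp add: algebra_simps)

lemma shift_one [simp]: "shift k 1 = 1"
  using shift_single[of k 0 1] by simp

lemma shift_prod [simp]: "shift k (prod f A) = (\<Prod>x\<in>A. shift k (f x))"
  by (induction A rule: infinite_finite_induct) auto

lemma shift_u [simp]: "shift k (u j) = u (j + k)"
  by (simp add: u_def shift_single shift_monom_single)

lemma shift_shift [simp]: "shift k (shift l f) = shift (k + l) f"
  by (induction f rule: dpoly_induct) (auto simp: shift_single shift_monom_shift_monom)

lemma shift_0 [simp]: "shift 0 f = f"
  by (induction f rule: dpoly_induct) (auto simp: shift_single)

lemma lookup_shift [simp]:
  "Poly_Mapping.lookup (shift k f) (shift_monom k m) = Poly_Mapping.lookup f m"
  by (induction f rule: dpoly_induct)
    (auto simp: shift_single lookup_add lookup_single when_def inj_eq[OF inj_shift_monom])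

lemma keys_shift: "Poly_Mapping.keys (shift k f) = shift_monom k ` Poly_Mapping.keys f"
proof (intro equalityI subsetI)
  fix m assume "m \<in> Poly_Mapping.keys (shift k f)"
  moreover have "m = shift_monom k (shift_monom (- k) m)"
    by (simp add: shift_monom_shift_monom)
  ultimately show "m \<in> shift_monom k ` Poly_Mapping.keys f"
    by (metis image_eqI in_keys_iff lookup_shift)
qed (auto simp: in_keys_iff)

lemma vars_shift: "vars (shift k f) = (\<lambda>j. j + k) ` vars f"
  by (auto simp: vars_def keys_shift keys_shift_monom)

lemma finite_vars [simp]: "finite (vars f)"
  by (simp add: vars_def)

lemma vars_add: "vars (f + g) \<subseteq> vars f \<union> vars g"
  using keys_add[of f g] by (auto simp: vars_def)

lemma vars_mult: "vars (f * g) \<subseteq> vars f \<union> vars g"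
proof
  fix j assume "j \<in> vars (f * g)"
  then obtain m where m: "m \<in> Poly_Mapping.keys (f * g)" "j \<in> Poly_Mapping.keys m"
    by (auto simp: vars_def)
  then obtain a b where "m = a + b" "a \<in> Poly_Mapping.keys f" "b \<in> Poly_Mapping.keys g"
    using keys_mult[of f g] by auto
  then show "j \<in> vars f \<union> vars g"
    using m(2) keys_add[of a b] by (auto simp: vars_def)
qed

lemma vars_u [simp]: "vars (u j) = {j}"
  by (simp add: vars_def u_def)

section \<open>Partial derivatives and the Frechet derivative\<close>

lemma pd_single: "pd j (Poly_Mapping.single m a) = Poly_Mapping.single
    (m - Poly_Mapping.single j 1) (of_nat (Poly_Mapping.lookup m j) * (a::'a::field_char_0))"
  by (simp add: pd_def)

lemma pd_add: "pd j (f + g) = pd j f + pd j g"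
  unfolding pd_def by (rule setsum_keys_plus_distrib) (auto simp: single_add algebra_simps)

lemma pd_mult: "pd j (f * g) = pd j f * g + f * pd j g"
proof (induction f rule: dpoly_induct)
  case (single m a)
  show ?case
  proof (induction g rule: dpoly_induct)
    case (single n b)
    let ?e = "Poly_Mapping.single j (1::nat)"
    \<comment> \<open>Subtraction of exponents is truncated, so the variable must occur in
      \<open>m\<close>; otherwise its exponent makes the coefficient 0.\<close>
    have *: "m - ?e + n = m + n - ?e" if "Poly_Mapping.lookup m j \<noteq> 0" for m n
      using that by (intro poly_mapping_eqI) (auto simp: lookup_add lookup_minus lookup_single when_def)
    have 1: "pd j (Poly_Mapping.single m a) * Poly_Mapping.single n b =
        Poly_Mapping.single (m + n - ?e) (of_nat (Poly_Mapping.lookup m j) * a * b)" for m n and a b :: 'a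
      using *[of m n] by (cases "Poly_Mapping.lookup m j = 0") (simp_all add: pd_single mult_single)
    have "pd j (Poly_Mapping.single m a * Poly_Mapping.single n b) =
        Poly_Mapping.single (m + n - ?e) (of_nat (Poly_Mapping.lookup m j) * a * b) +
        Poly_Mapping.single (n + m - ?e) (of_nat (Poly_Mapping.lookup n j) * b * a)"
      by (simp add: mult_single pd_single lookup_add add.commute[of n m] flip: single_add)
        (simp add: algebra_simps)
    also have "\<dots> = pd j (Poly_Mapping.single m a) * Poly_Mapping.single n b +
        Poly_Mapping.single m a * pd j (Poly_Mapping.single n b)"
      using 1[of m a n b] 1[of n b m a] by (simp add: mult.commute)
    finally show ?case .
  qed (simp_all only: pd_add distrib_left distrib_right add_ac)
qed (simp_all only: pd_add distrib_left distrib_right add_ac)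

lemma pd_u: "pd j (u k) = (if j = k then 1 else 0)"
  by (auto simp: u_def pd_single lookup_single when_def simp flip: single_one)

lemma pd_eq_0: "j \<notin> vars f \<Longrightarrow> pd j f = 0"
  unfolding pd_def by (rule sum.neutral) (auto simp: vars_def in_keys_iff)

lemma pd_shift: "pd (j + k) (shift k f) = shift k (pd j f)"
  by (induction f rule: dpoly_induct)
    (auto simp: pd_add shift_single pd_single shift_monom_diff shift_monom_single)

text \<open>Additivity and the Leibniz rule compare polynomials with different variables, which
  calls for one common index set.\<close>

lemma frechet_eq_sum:
  assumes "finite J" "vars f \<subseteq> J"
  shows "frechet f Q = (\<Sum>j\<in>J. pd j f * shift j Q)"
  unfolding frechet_def using assms by (intro sum.mono_neutral_left) (auto simp: pd_eq_0)

lemma frechet_add [simp]: "frechet (f + g) Q = frechet f Q + frechet g Q"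
  using vars_add[of f g]
  by (simp add: frechet_eq_sum[of "vars f \<union> vars g"] pd_add algebra_simps sum.distrib)

lemma frechet_mult: "frechet (f * g) Q = frechet f Q * g + f * frechet g Q"
  using vars_mult[of f g]
  by (simp add: frechet_eq_sum[of "vars f \<union> vars g"] pd_mult algebra_simps sum.distrib sum_distrib_left)

lemma frechet_u [simp]: "frechet (u j) Q = shift j Q"
  by (simp add: frechet_def pd_u)

lemma frechet_zero [simp]: "frechet 0 Q = 0"
  by (simp add: frechet_def vars_def)

lemma frechet_one [simp]: "frechet 1 Q = 0"
  by (simp add: frechet_def vars_def)

lemma frechet_uminus [simp]: "frechet (- f) Q = - frechet f Q"
  using frechet_add[of "- f" f] by (simp add: eq_neg_iff_add_eq_0)

lemma frechet_diff [simp]: "frechet (f - g) Q = frechet f Q - frechet g Q"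
  using frechet_add[of f "- g"] by simp

lemma frechet_sum [simp]: "frechet (sum f A) Q = (\<Sum>x\<in>A. frechet (f x) Q)"
  by (induction A rule: infinite_finite_induct) auto

lemma frechet_shift [simp]: "frechet (shift k f) Q = shift k (frechet f Q)"
proof -
  have "frechet (shift k f) Q = (\<Sum>j\<in>vars f. pd (j + k) (shift k f) * shift (j + k) Q)"
    unfolding frechet_def vars_shift by (subst sum.reindex) auto
  then show ?thesis
    by (simp add: frechet_def pd_shift add.commute)
qed

section \<open>Injectivity of the operators to be inverted\<close>

definition monom_deg :: "(int \<Rightarrow>\<^sub>0 nat) \<Rightarrow> int" where
  "monom_deg m = (\<Sum>j\<in>Poly_Mapping.keys m. int (Poly_Mapping.lookup m j))"

text \<open>The sum of the indices with multiplicity; a shift by \<open>k\<close> raises it by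
  \<open>k\<close> times the degree.\<close>

definition monom_weight :: "(int \<Rightarrow>\<^sub>0 nat) \<Rightarrow> int" where
  "monom_weight m = (\<Sum>j\<in>Poly_Mapping.keys m. j * int (Poly_Mapping.lookup m j))"

lemma monom_deg_nonneg [simp]: "monom_deg m \<ge> 0"
  by (simp add: monom_deg_def sum_nonneg)

lemma monom_deg_eq_0_iff [simp]: "monom_deg m = 0 \<longleftrightarrow> m = 0"
  by (auto simp: monom_deg_def sum_nonneg_eq_0_iff in_keys_iff intro!: poly_mapping_eqI)

lemma monom_weight_add: "monom_weight (m + n) = monom_weight m + monom_weight n"
  unfolding monom_weight_def by (rule setsum_keys_plus_distrib) (auto simp: algebra_simps)

lemma monom_weight_shift: "monom_weight (shift_monom k m) = monom_weight m + k * monom_deg m"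
  unfolding monom_weight_def monom_deg_def keys_shift_monom
  by (subst sum.reindex) (auto simp: algebra_simps sum.distrib sum_distrib_left)

lemma monom_weight_single [simp]: "monom_weight (Poly_Mapping.single j a) = j * int a"
  by (simp add: monom_weight_def)

text \<open>Multiplication by a variable is injective on monomials, so nothing cancels and the
  support is translated.\<close>

lemma keys_u_mult: "Poly_Mapping.keys (u j * f) =
    (+) (Poly_Mapping.single j 1) ` Poly_Mapping.keys f"
proof -
  have *: "Poly_Mapping.lookup (u j * f) (Poly_Mapping.single j 1 + m) = Poly_Mapping.lookup f m" for m
    by (induction f rule: dpoly_induct)
      (auto simp: u_def mult_single lookup_add lookup_single when_def algebra_simps)
  show ?thesis
  proof (intro equalityI subsetI)
    fix m assume "m \<in> Poly_Mapping.keys (u j * f)"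
    then show "m \<in> (+) (Poly_Mapping.single j 1) ` Poly_Mapping.keys f"
      using keys_mult[of "u j" f] by (auto simp: u_def)
  qed (auto simp: in_keys_iff * simp del: One_nat_def)
qed

text \<open>If an operator and its rival map the monomials of \<open>f\<close> to the same set of monomials, the total
  weights agree; when each monomial gains at least its degree in weight, only the constant survives.\<close>

lemma eq_0_if_weight_gain:
  assumes img: "\<phi> ` Poly_Mapping.keys f = \<psi> ` Poly_Mapping.keys f"
    and inj: "inj \<phi>" "inj \<psi>"
    and gain: "\<And>m. monom_weight (\<phi> m) \<ge> monom_weight (\<psi> m) + monom_deg m"
    and "const_term f = 0"
  shows "f = 0"
proof -
  let ?T = "Poly_Mapping.keys f"
  have "(\<Sum>m\<in>?T. monom_weight (\<phi> m)) = (\<Sum>m\<in>?T. monom_weight (\<psi> m))"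
    using sum.reindex[OF inj_on_subset[OF inj(1) subset_UNIV], of monom_weight ?T]
      sum.reindex[OF inj_on_subset[OF inj(2) subset_UNIV], of monom_weight ?T] img by simp
  moreover have "(\<Sum>m\<in>?T. monom_weight (\<phi> m)) \<ge> (\<Sum>m\<in>?T. monom_weight (\<psi> m) + monom_deg m)"
    by (intro sum_mono gain)
  ultimately have "(\<Sum>m\<in>?T. monom_deg m) \<le> 0"
    by (simp add: sum.distrib)
  then have "(\<Sum>m\<in>?T. monom_deg m) = 0"
    by (intro antisym sum_nonneg) auto
  then have "\<forall>m\<in>?T. m = 0"
    by (simp add: sum_nonneg_eq_0_iff)
  then show ?thesis
    using assms(5) by (intro poly_mapping_eqI) (metis const_term_def in_keys_iff lookup_zero)
qed

lemma const_term_diff [simp]: "const_term (f - g) = const_term f - const_term g"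
  by (simp add: const_term_def lookup_minus)

lemma const_term_zero [simp]: "const_term 0 = 0"
  by (simp add: const_term_def)

lemma const_term_add [simp]: "const_term (f + g) = const_term f + const_term g"
  by (simp add: const_term_def lookup_add)

lemma const_term_mult_u [simp]: "const_term (f * u j) = 0"
proof -
  have "0 \<notin> Poly_Mapping.keys (u j * f)"
    unfolding keys_u_mult
  proof
    assume "0 \<in> (+) (Poly_Mapping.single j (1::nat)) ` Poly_Mapping.keys f"
    then obtain m where "0 = Poly_Mapping.single j (1::nat) + m" by auto
    then have "Poly_Mapping.lookup (Poly_Mapping.single j (1::nat) + m) j = 0" by (metis lookup_zero)
    then show False by (simp add: lookup_add)
  qed
  then show ?thesis by (simp add: const_term_def in_keys_iff mult.commute)
qed

lemma const_term_shift [simp]: "const_term (shift k f) = const_term f"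
  using lookup_shift[of k f 0] by (simp add: const_term_def)

text \<open>The difference of two preimages is shift invariant, while a shift by 1 raises the weight
  of each monomial by its degree.\<close>

lemma shift_1_minus_id_inj:
  assumes "shift 1 f - f = shift 1 g - g" "const_term f = 0" "const_term g = 0"
  shows "f = g"
proof -
  have "shift 1 (f - g) = f - g"
    using assms(1) by (simp add: algebra_simps)
  then have "shift_monom 1 ` Poly_Mapping.keys (f - g) = (\<lambda>m. m) ` Poly_Mapping.keys (f - g)"
    using keys_shift[of 1 "f - g"] by simp
  then have "f - g = 0"
    using assms by (intro eq_0_if_weight_gain[of "shift_monom 1" _ "\<lambda>m. m"])
      (auto simp: inj_shift_monom monom_weight_shift)
  then show ?thesis by simp
qed

text \<open>On the difference of two preimages both halves of the operator have the same support.
  Their effects on the weight of \<open>m\<close> differ by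
  \<open>r + (r + i) * monom_deg m\<close>, which is at least the degree.\<close>

lemma two_term_inj:
  assumes "two_term r i f = two_term r i g" "const_term f = 0" "const_term g = 0" "r \<ge> 0" "i > 0"
  shows "f = g"
proof -
  let ?h = "f - g" and ?e = "Poly_Mapping.single 0 (1::nat)"
  have "shift r (u 0 * ?h) = u 0 * shift (- i) ?h"
    using assms(1) by (simp add: two_term_def algebra_simps)
  then have "(\<lambda>m. shift_monom r (?e + m)) ` Poly_Mapping.keys ?h =
      (\<lambda>m. ?e + shift_monom (- i) m) ` Poly_Mapping.keys ?h"
    using keys_shift[of r "u 0 * ?h"] keys_u_mult[of 0 "shift (- i) ?h"]
    by (simp only: keys_shift keys_u_mult image_image)
  moreover have "inj (\<lambda>m. shift_monom r (?e + m))" "inj (\<lambda>m. ?e + shift_monom (- i) m)"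
    by (auto intro!: injI simp: inj_eq[OF inj_shift_monom])
  moreover have "r * monom_deg m + i * monom_deg m \<ge> monom_deg m" for m
    using assms(4,5) mult_right_mono[of 1 "r + i" "monom_deg m"] by (simp add: algebra_simps)
  then have "r + (r * monom_deg m + i * monom_deg m) \<ge> monom_deg m" for m
    using assms(4) by (simp add: add_increasing)
  ultimately have "?h = 0"
    using assms by (intro eq_0_if_weight_gain[of "\<lambda>m. shift_monom r (?e + m)" _
          "\<lambda>m. ?e + shift_monom (- i) m"])
      (auto simp: shift_monom_add shift_monom_single monom_weight_add monom_weight_shift algebra_simps)
  then show ?thesis by simp
qed

text \<open>Every inverse below is evaluated this way: an explicit preimage together with
  injectivity.\<close>

lemma inv_op_eq_Some:
  assumes "const_term f = 0" "B f = g"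
    and "\<And>h. const_term h = 0 \<Longrightarrow> B h = B f \<Longrightarrow> h = f"
  shows "inv_op B g = Some f"
proof -
  have *: "h = f" if "const_term h = 0 \<and> B h = g" for h
    using assms(3)[of h] assms(2) that by metis
  have "(THE h. const_term h = 0 \<and> B h = g) = f"
    by (rule the_equality, rule conjI[OF assms(1,2)], rule *)
  moreover have "\<exists>!h. const_term h = 0 \<and> B h = g"
    by (rule ex1I, rule conjI[OF assms(1,2)], rule *)
  ultimately show ?thesis by (simp add: inv_op_def)
qed

section \<open>Powers of the Lax operator\<close>

text \<open>\<open>lax_coeff p n q\<close> is the coefficient of \<open>\<S>\<close> to the power \<open>n - (p + 1) q\<close> in \<open>L\<^sup>n\<close>, where
  \<open>L = \<S> + u \<S>\<^sup>-\<^sup>p\<close>. The recursion reads off \<open>L\<^sup>n L\<close>; lemma \<open>lax_coeff_left\<close> reads off \<open>L L\<^sup>n\<close>.\<close>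

fun lax_coeff :: "nat \<Rightarrow> nat \<Rightarrow> nat \<Rightarrow> 'a::field_char_0 dpoly" where
  "lax_coeff p n 0 = 1"
| "lax_coeff p 0 (Suc q) = 0"
| "lax_coeff p (Suc n) (Suc q) =
     lax_coeff p n (Suc q) + lax_coeff p n q * u (int n - (int p + 1) * int q)"

lemma lax_coeff_left:
  "lax_coeff p (Suc n) (Suc q) =
     shift 1 (lax_coeff p n (Suc q) :: 'a::field_char_0 dpoly) + u 0 * shift (- int p) (lax_coeff p n q)"
proof (induction n arbitrary: q)
  case 0
  show ?case by (cases q) simp_all
next
  case (Suc n)
  note IH = Suc.IH
  let ?M = "int (Suc n) - (int p + 1) * int q"
  \<comment> \<open>One \<open>lax_coeff p (Suc n) q\<close> is expanded from the right by
    definition, the other from the left by induction; the shift by \<open>- int p\<close> carries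
    the variable for \<open>r = q - 1\<close> to \<open>u ?M\<close>.\<close>
  have *: "u 0 * shift (- int p) (lax_coeff p n q :: 'a dpoly) + lax_coeff p (Suc n) q * u ?M =
      shift 1 (lax_coeff p n q) * u ?M + u 0 * shift (- int p) (lax_coeff p (Suc n) q)"
  proof (cases q)
    case 0
    then show ?thesis by simp
  next
    case (Suc r)
    have "u 0 * shift (- int p) (lax_coeff p (Suc n) q) = u 0 * shift (- int p) (lax_coeff p n q :: 'a dpoly) +
        u 0 * shift (- int p) (lax_coeff p n r) * u ?M"
      by (simp add: Suc algebra_simps)
    moreover have "lax_coeff p (Suc n) q = shift 1 (lax_coeff p n q :: 'a dpoly) +
        u 0 * shift (- int p) (lax_coeff p n r)"
      unfolding Suc by (rule IH)
    ultimately show ?thesis by (simp only: distrib_right add_ac)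
  qed
  have "lax_coeff p (Suc (Suc n)) (Suc q) = shift 1 (lax_coeff p n (Suc q) :: 'a dpoly) +
      (u 0 * shift (- int p) (lax_coeff p n q) + lax_coeff p (Suc n) q * u ?M)"
    by (subst lax_coeff.simps(3), subst Suc.IH) (simp only: add_ac)
  also have "\<dots> = shift 1 (lax_coeff p (Suc n) (Suc q)) + u 0 * shift (- int p) (lax_coeff p (Suc n) q)"
    unfolding * by (simp add: algebra_simps)
  finally show ?case .
qed

lemma lax_coeff_eq_0: "n < q \<Longrightarrow> lax_coeff p n q = 0"
  by (induction p n q rule: lax_coeff.induct) auto

lemma lax_coeff_one: "lax_coeff p n 1 = (\<Sum>k<n. u (int k))"
  by (induction n) simp_all

lemma const_term_lax_coeff [simp]: "const_term (lax_coeff p n (Suc q)) = 0"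
  by (induction n) simp_all

section \<open>Recursions for the homogeneous polynomials\<close>

lemma case_nat_index_tuples:
  assumes "mu \<in> index_tuples l k"
  shows "case_nat k mu \<in> index_tuples (Suc l) k"
proof -
  have 1: "mu j \<le> k" if "j < l" for j
    using assms that by (auto simp: index_tuples_def PiE_def Pi_def)
  have 2: "mu j = undefined" if "\<not> j < l" for j
    using assms that by (auto simp: index_tuples_def PiE_def extensional_def)
  have 3: "mu j \<le> mu i" if "i \<le> j" "j < l" for i j
    using assms that by (auto simp: index_tuples_def monotone_on_def)
  show ?thesis
    unfolding index_tuples_def using 1 2 3
    by (auto simp: PiE_def Pi_def extensional_def monotone_on_def split: nat.splits)
qed

lemma shift_index_tuples:
  assumes "lam \<in> index_tuples (Suc l) k"
  shows "(\<lambda>j. lam (Suc j)) \<in> index_tuples l k"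
  using assms by (auto simp: index_tuples_def PiE_def Pi_def extensional_def monotone_on_def)

text \<open>Deleting the first entry \<open>k\<close> is a bijection onto the shorter tuples with
  the same bound. Every other position drops by one, which the shift by \<open>p\<close>
  compensates.\<close>

lemma hpoly_sum_max_first:
  "(\<Sum>lam\<in>{lam \<in> index_tuples (Suc l) k. lam 0 = k}. \<Prod>j=0..<Suc l. u (int (lam j + j * p))) =
     u (int k) * shift (int p) (hpoly p l k :: 'a::field_char_0 dpoly)"
proof -
  have "(\<Sum>lam\<in>{lam \<in> index_tuples (Suc l) k. lam 0 = k}.
            \<Prod>j=0..<Suc l. u (int (lam j + j * p)) :: 'a dpoly) =
      (\<Sum>mu\<in>index_tuples l k. u (int k) * (\<Prod>j=0..<l. u (int (mu j + j * p) + int p)))"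
  proof (rule sum.reindex_bij_witness[of _ "case_nat k" "\<lambda>lam j. lam (Suc j)"])
    fix lam assume "lam \<in> {lam \<in> index_tuples (Suc l) k. lam 0 = k}"
    then show "case_nat k (\<lambda>j. lam (Suc j)) = lam"
      by (auto simp: fun_eq_iff split: nat.splits)
  next
    fix lam assume "lam \<in> {lam \<in> index_tuples (Suc l) k. lam 0 = k}"
    then show "u (int k) * (\<Prod>j=0..<l. u (int (lam (Suc j) + j * p) + int p)) =
        (\<Prod>j=0..<Suc l. u (int (lam j + j * p)) :: 'a dpoly)"
      by (subst prod.atLeast0_lessThan_Suc_shift) (simp add: algebra_simps)
  qed (auto simp: case_nat_index_tuples shift_index_tuples)
  then show ?thesis
    by (simp add: hpoly_def sum_distrib_left)
qed

lemma finite_index_tuples [simp]: "finite (index_tuples l k)"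
  unfolding index_tuples_def by (rule finite_subset[of _ "{0..<l} \<rightarrow>\<^sub>E {0..k}"]) (auto intro: finite_PiE)

lemma hpoly_0: "hpoly p 0 k = 1"
proof -
  have "index_tuples 0 k = {\<lambda>_. undefined}"
    by (auto simp: index_tuples_def monotone_on_def)
  then show ?thesis by (simp add: hpoly_def)
qed

lemma hpoly_Suc_0: "hpoly p (Suc l) 0 = u 0 * shift (int p) (hpoly p l 0)"
proof -
  have "{lam \<in> index_tuples (Suc l) 0. lam 0 = 0} = index_tuples (Suc l) 0"
    by (auto simp: index_tuples_def PiE_def Pi_def)
  then have "hpoly p (Suc l) 0 = (\<Sum>lam\<in>{lam \<in> index_tuples (Suc l) 0. lam 0 = 0}.
      \<Prod>j=0..<Suc l. u (int (lam j + j * p)))"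
    by (simp only: hpoly_def)
  then show ?thesis
    by (simp only: hpoly_sum_max_first of_nat_0)
qed

text \<open>Either the largest entry \<open>lam 0\<close> is \<open>Suc k\<close>, or by
  monotonicity all entries are at most \<open>k\<close>.\<close>

lemma hpoly_Suc_Suc:
  "hpoly p (Suc l) (Suc k) =
     hpoly p (Suc l) k + u (int (Suc k)) * shift (int p) (hpoly p l (Suc k) :: 'a::field_char_0 dpoly)"
proof -
  let ?A = "index_tuples (Suc l) k" and ?B = "{lam \<in> index_tuples (Suc l) (Suc k). lam 0 = Suc k}"
  have "lam \<in> ?A" if lam: "lam \<in> index_tuples (Suc l) (Suc k)" "lam 0 \<noteq> Suc k" for lam
  proof -
    have "lam j \<le> k" if "j < Suc l" for j
    proof -
      have "lam j \<le> lam 0" "lam 0 \<le> Suc k"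
        using lam that by (auto simp: index_tuples_def monotone_on_def PiE_def Pi_def)
      then show ?thesis using lam by simp
    qed
    then show ?thesis using lam by (auto simp: index_tuples_def PiE_def Pi_def)
  qed
  moreover have "?A \<subseteq> index_tuples (Suc l) (Suc k)"
    by (auto simp: index_tuples_def PiE_def Pi_def le_SucI)
  ultimately have "index_tuples (Suc l) (Suc k) = ?A \<union> ?B"
    by blast
  then have "sum f (index_tuples (Suc l) (Suc k)) = sum f (?A \<union> ?B)" for f :: "_ \<Rightarrow> 'a dpoly"
    by (rule arg_cong)
  also have "sum f (?A \<union> ?B) = sum f ?A + sum f ?B" for f :: "_ \<Rightarrow> 'a dpoly"
    by (rule sum.union_disjoint) (simp_all, auto simp: index_tuples_def PiE_def Pi_def)
  finally have "hpoly p (Suc l) (Suc k) = hpoly p (Suc l) k +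
      (\<Sum>lam\<in>?B. \<Prod>j=0..<Suc l. u (int (lam j + j * p)) :: 'a dpoly)"
    unfolding hpoly_def .
  then show ?thesis
    by (simp only: hpoly_sum_max_first)
qed

text \<open>Up to the shift, splitting off the largest entry is the recursion for multiplying by
  \<open>L\<close> on the right.\<close>

lemma hpoly_eq_lax_coeff:
  "hpoly p q k = shift ((int q - 1) * int p) (lax_coeff p (k + q) q)"
proof (induction q arbitrary: k)
  case 0
  show ?case by (simp add: hpoly_0)
next
  case (Suc q)
  \<comment> \<open>Saved because the inner induction on \<open>k\<close> reuses the name
    \<open>Suc.IH\<close>.\<close>
  note Suc_q = Suc.IH
  show ?case
  proof (induction k)
    case 0
    show ?case by (simp add: hpoly_Suc_0 Suc_q lax_coeff_eq_0 algebra_simps)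
  next
    case (Suc k)
    show ?case by (simp add: hpoly_Suc_Suc Suc.IH Suc_q algebra_simps)
  qed
qed

text \<open>The coefficient is that of \<open>\<S>\<^sup>0\<close> in the power
  \<open>(p + 1) * m\<close> of \<open>L\<close>. The numbering is one ahead: \<open>m = 1\<close>
  gives the lattice and \<open>m = Suc l\<close> gives \<open>Q\<^sup>l\<close>.\<close>

definition NIB_flow :: "nat \<Rightarrow> nat \<Rightarrow> 'a::field_char_0 dpoly" where
  "NIB_flow p m = u 0 * (lax_coeff p ((p + 1) * m) m - shift (- int p) (lax_coeff p ((p + 1) * m) m))"

lemma lax_coeff_right:
  "N = (p + 1) * q + r \<Longrightarrow>
     lax_coeff p (Suc N) (Suc q) = lax_coeff p N (Suc q) + lax_coeff p N q * u (int r)"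
  by (simp add: algebra_simps)

text \<open>Subtract the two expansions of \<open>lax_coeff p (Suc N) (Suc q)\<close>. This supplies
  the preimages under \<open>\<S> - 1\<close>.\<close>

lemma lax_coeff_diff:
  assumes "N = (p + 1) * q + r"
  shows "(shift 1 (lax_coeff p N (Suc q)) - lax_coeff p N (Suc q) :: 'a::field_char_0 dpoly) =
     u (int r) * lax_coeff p N q - u 0 * shift (- int p) (lax_coeff p N q)"
  using lax_coeff_right[where ?'a = 'a, OF assms] lax_coeff_left[where ?'a = 'a, of p N q]
  by (simp add: algebra_simps del: lax_coeff.simps)

text \<open>The left side is the numerator of one factor of the recursion operator applied to
  \<open>shift (- int r)\<close> of a coefficient. The right side is the operator inverted by the
  next factor, applied to the next coefficient shifted once more.\<close>

lemma lax_coeff_transfer: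
  assumes "m > 0" "N = (p + 1) * m + r"
  shows "u (int r + 1) * shift 1 (lax_coeff p N m :: 'a::field_char_0 dpoly) - u 0 * shift (- int p) (lax_coeff p N m) =
    u (int r + 1) * lax_coeff p (Suc N) m - u 0 * shift (- int p) (lax_coeff p (Suc N) m)"
proof -
  obtain l where l: "m = Suc l" using assms by (cases m) auto
  \<comment> \<open>Relative to \<open>l = m - 1\<close> the remainder is \<open>p + 1 + r\<close>;
    the shift by \<open>- int p\<close> turns the last variable into
    \<open>u (int r + 1)\<close>.\<close>
  have right: "(lax_coeff p (Suc N) m :: 'a dpoly) = lax_coeff p N m + lax_coeff p N l * u (int r + 1 + int p)"
    using lax_coeff_right[where ?'a = 'a, of N p l "p + 1 + r"] assms l by (simp add: algebra_simps del: lax_coeff.simps)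
  have left: "shift 1 (lax_coeff p N m :: 'a dpoly) = lax_coeff p (Suc N) m - u 0 * shift (- int p) (lax_coeff p N l)"
    unfolding l lax_coeff_left by simp
  have "shift (- int p) (lax_coeff p (Suc N) m :: 'a dpoly) =
      shift (- int p) (lax_coeff p N m) + shift (- int p) (lax_coeff p N l) * u (int r + 1)"
    unfolding right by simp
  then show ?thesis
    unfolding left by (simp add: algebra_simps del: lax_coeff.simps)
qed

text \<open>Expand the first coefficient from the left and the second from the right; the extra
  terms cancel because the shift takes \<open>u (int p)\<close> to \<open>u 0\<close>.\<close>

lemma lax_coeff_shift_diff:
  assumes "N = (p + 1) * q + p"
  shows "lax_coeff p (Suc N) (Suc q) - shift (- int p) (lax_coeff p (Suc N) (Suc q)) =
    shift 1 (lax_coeff p N (Suc q)) - shift (- int p) (lax_coeff p N (Suc q))"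
  by (subst lax_coeff_left, subst lax_coeff_right[OF assms]) (simp add: algebra_simps)

lemma NIB_flow_Suc:
  assumes "N = (p + 1) * q + p"
  shows "NIB_flow p (Suc q) = u 0 * (shift 1 (lax_coeff p N (Suc q)) - shift (- int p) (lax_coeff p N (Suc q)))"
proof -
  have "(p + 1) * Suc q = Suc N" using assms by simp
  then show ?thesis
    unfolding NIB_flow_def by (simp only: lax_coeff_shift_diff[OF assms])
qed

text \<open>With remainder \<open>r = 0\<close> both variables in \<open>lax_coeff_diff\<close> are
  \<open>u 0\<close>, so each flow is a total difference.\<close>

lemma NIB_flow_eq_diff:
  "NIB_flow p m = shift 1 (lax_coeff p ((p + 1) * m) (Suc m)) - lax_coeff p ((p + 1) * m) (Suc m)"
  by (subst lax_coeff_diff[where r = 0]) (simp_all add: NIB_flow_def right_diff_distrib)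

lemma NIB_flow_eq_hpoly:
  "NIB_flow p (Suc l) =
     (let F = shift (1 - int l * int p) (hpoly p (l + 1) ((l + 1) * p - 1))
      in u 0 * (F - shift (- (int p + 1)) F))" if "p \<ge> 1"
proof -
  \<comment> \<open>Here \<open>p \<ge> 1\<close> keeps the truncated subtraction exact.\<close>
  have "(l + 1) * p - 1 + (l + 1) = (p + 1) * l + p"
    using that by (cases p) (simp_all add: algebra_simps)
  then have F: "shift (1 - int l * int p) (hpoly p (l + 1) ((l + 1) * p - 1)) =
      shift 1 (lax_coeff p ((p + 1) * l + p) (Suc l))"
    by (simp only: hpoly_eq_lax_coeff shift_shift) (simp del: lax_coeff.simps)
  show ?thesis
    unfolding NIB_flow_Suc[OF refl] Let_def F by (simp del: lax_coeff.simps)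
qed

section \<open>Locality\<close>

text \<open>Invariant after the \<open>r + 1\<close> rightmost factors: each inverse yields the next
  coefficient with one more backward shift, and the numerator of factor \<open>p - r\<close> is then
  applied.\<close>

lemma rec_factors_NIB_flow:
  assumes "m > 0" "r < p"
  shows "ordered_prod (map (rec_factor p) [p - r..<p + 1]) (NIB_flow p m :: 'a::field_char_0 dpoly) =
    Some (two_term (int r + 1) (int p - int r) (shift (- int r) (lax_coeff p ((p + 1) * m + r) m)))"
  using assms(2)
proof (induction r)
  case 0
  let ?c = "lax_coeff p ((p + 1) * m) m :: 'a dpoly"
  \<comment> \<open>The rightmost factor has \<open>i = p\<close> and inverts
    \<open>u - u \<S>\<^sup>-\<^sup>p\<close>, which maps \<open>?c\<close> to the flow by
    definition.\<close>
  have "inv_op (two_term 0 (int p)) (NIB_flow p m) = Some ?c"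
  proof (rule inv_op_eq_Some)
    show c: "const_term ?c = 0" using assms by (cases m) (simp_all del: lax_coeff.simps)
    show "h = ?c" if "const_term h = 0" "two_term 0 (int p) h = two_term 0 (int p) ?c" for h
      by (rule two_term_inj[OF that(2,1) c]) (use 0 in auto)
    show "two_term 0 (int p) ?c = NIB_flow p m"
      by (simp add: two_term_def NIB_flow_def algebra_simps)
  qed
  then show ?case
    by (simp add: ordered_prod_def rec_factor_def map_comp_def total_op_def)
next
  case (Suc r)
  let ?g = "two_term (int r + 1) (int p - int r) (shift (- int r) (lax_coeff p ((p + 1) * m + r) m)) :: 'a dpoly"
  let ?f = "shift (- int (Suc r)) (lax_coeff p ((p + 1) * m + Suc r) m) :: 'a dpoly"
  let ?i = "p - Suc r"
  have i: "int ?i = int p - int r - 1" "[?i..<p + 1] = ?i # [p - r..<p + 1]"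
    using Suc.prems by (simp_all add: upt_conv_Cons Suc_diff_Suc)
  have "inv_op (two_term (int p - int ?i) (int ?i)) ?g = Some ?f"
  proof (rule inv_op_eq_Some)
    show c: "const_term ?f = 0" using assms(1) by (cases m) (simp_all del: lax_coeff.simps)
    show "h = ?f" if "const_term h = 0"
      "two_term (int p - int ?i) (int ?i) h = two_term (int p - int ?i) (int ?i) ?f" for h
      by (rule two_term_inj[OF that(2,1) c]) (use Suc.prems in auto)
    show "two_term (int p - int ?i) (int ?i) ?f = ?g"
      using lax_coeff_transfer[OF assms(1) refl, symmetric, where p = p and r = r and ?'a = 'a]
      by (simp add: two_term_def i(1) algebra_simps del: lax_coeff.simps)
  qed
  then show ?case
    using Suc.IH Suc.prems unfolding i(2)
    by (simp add: ordered_prod_def rec_factor_def map_comp_def total_op_def i(1) algebra_simps)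
qed

text \<open>After all \<open>p\<close> factors, \<open>lax_coeff_transfer\<close> with
  \<open>r = p - 1\<close> gives the form that \<open>lax_coeff_diff\<close> recognises as a
  difference; the outermost factor then produces the flow as in \<open>NIB_flow_Suc\<close>.\<close>

lemma rec_op_NIB_flow:
  assumes "p \<ge> 1" "m > 0"
  shows "rec_op p (NIB_flow p m :: 'a::field_char_0 dpoly) = Some (NIB_flow p (Suc m))"
proof -
  define N where "N = (p + 1) * m + (p - 1)"
  have N: "Suc N = (p + 1) * m + p" using assms by (simp add: N_def)
  let ?H = "lax_coeff p (Suc N) (Suc m) :: 'a dpoly"
  let ?g = "two_term (int p) 1 (shift (1 - int p) (lax_coeff p N m)) :: 'a dpoly"
  have "ordered_prod (map (rec_factor p) [1..<p + 1]) (NIB_flow p m) = Some ?g"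
    using rec_factors_NIB_flow[OF assms(2), of "p - 1" p] assms(1)
    by (simp add: N_def of_nat_diff del: upt_Suc)
  moreover have "inv_op (\<lambda>f. shift 1 f - f) ?g = Some ?H"
  proof (rule inv_op_eq_Some)
    show c: "const_term ?H = 0" by (rule const_term_lax_coeff)
    show "h = ?H" if "const_term h = 0" "shift 1 h - h = shift 1 ?H - ?H" for h
      by (rule shift_1_minus_id_inj[OF that(2,1) c])
    have "shift 1 ?H - ?H = u (int p) * lax_coeff p (Suc N) m - u 0 * shift (- int p) (lax_coeff p (Suc N) m)"
      by (rule lax_coeff_diff[OF N])
    also have "\<dots> = ?g"
      using lax_coeff_transfer[OF assms(2) N_def, symmetric] assms(1)
      by (simp add: two_term_def of_nat_diff del: lax_coeff.simps)
    finally show "shift 1 ?H - ?H = ?g" .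
  qed
  ultimately show ?thesis
    by (simp add: rec_op_def map_comp_def total_op_def NIB_flow_Suc[OF N] del: lax_coeff.simps upt_Suc)
qed

lemma NIB_flow_1: "NIB_flow p 1 =
  u 0 * ((\<Sum>k=0..p. u (int k)) - shift (- int p) (\<Sum>k=0..p. u (int k)))"
proof -
  have "{..<(p + 1) * 1} = {0..p}" by auto
  then show ?thesis by (simp only: NIB_flow_def lax_coeff_one)
qed

text \<open>Both sums starting at \<open>k = 0\<close> contain \<open>u 0\<close>, which
  cancels.\<close>

lemma NIB_eq_NIB_flow: "(NIB p :: 'a::field_char_0 dpoly) = NIB_flow p 1"
proof -
  have "(\<Sum>k=0..p. u (int k) :: 'a dpoly) = u 0 + (\<Sum>k=1..p. u (int k))"
    by (simp add: sum.atLeast_Suc_atMost)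
  moreover have "shift (- int p) (\<Sum>k=0..p. u (int k) :: 'a dpoly) = (\<Sum>k=0..p. u (- int k))"
    unfolding shift_sum
    by (rule sum.reindex_bij_witness[of _ "\<lambda>k. p - k" "\<lambda>k. p - k"]) (auto simp: of_nat_diff)
  moreover have "(\<Sum>k=0..p. u (- int k) :: 'a dpoly) = u 0 + (\<Sum>k=1..p. u (- int k))"
    by (simp add: sum.atLeast_Suc_atMost)
  ultimately show ?thesis
    unfolding NIB_flow_1 NIB_def by (simp only: add_diff_cancel_left)
qed

lemma op_power_NIB:
  assumes "p \<ge> 1"
  shows "op_power (rec_op p) l (NIB p) = Some (NIB_flow p (Suc l))"
proof (induction l)
  case 0
  show ?case by (simp add: op_power_def ordered_prod_def NIB_eq_NIB_flow)
next
  case (Suc l)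
  then show ?case
    using rec_op_NIB_flow[OF assms, of "Suc l"] by (simp add: op_power_def ordered_prod_def map_comp_def)
qed

section \<open>Commutation with the lattice\<close>

lemma shift_1_sum_u:
  "shift 1 (\<Sum>k=0..p. u (int k)) = (\<Sum>k=0..p. u (int k)) + u (int p + 1) - u 0"
  by (induction p) (simp_all add: algebra_simps)

text \<open>The Lax equation \<open>D\<^sub>K L\<^sup>n = [\<S>\<^bsup>p+1\<^esup> + a, L\<^sup>n]\<close>, coefficientwise.\<close>

lemma frechet_lax_coeff:
  fixes p :: nat
  defines "a \<equiv> (\<Sum>k=0..p. u (int k)) :: 'a::field_char_0 dpoly"
  shows "frechet (lax_coeff p n q) (NIB p) =
    shift (int p + 1) (lax_coeff p n (Suc q)) - lax_coeff p n (Suc q) +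
    (a - shift (int n - (int p + 1) * int q) a) * lax_coeff p n q"
proof -
  have K: "NIB p = u 0 * (a - shift (- int p) a)"
    unfolding NIB_eq_NIB_flow NIB_flow_1 a_def ..
  have a: "shift (j + 1) a = shift j a + u (j + int p + 1) - u j" for j
  proof -
    have "shift j (shift 1 a) = shift j (a + u (int p + 1) - u 0)"
      unfolding a_def shift_1_sum_u ..
    then show ?thesis by (simp add: algebra_simps)
  qed
  show ?thesis
  proof (induction n arbitrary: q)
    case 0
    show ?case by (cases q) simp_all
  next
    case (Suc n)
    note IH = Suc.IH
    show ?case
    proof (cases q)
      case 0
      \<comment> \<open>For \<open>q = 0\<close> the coefficient is 1 with derivative 0, so the
        induction hypothesis determines this shift.\<close>
      have "shift (int p + 1) (lax_coeff p n (Suc 0)) = lax_coeff p n (Suc 0) - a + shift (int n) a"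
        using IH[of 0] by (simp add: algebra_simps)
      moreover have "shift (int (Suc n)) a = shift (int n) a + u (int n + (int p + 1)) - u (int n)"
        using a[of "int n"] by (simp add: algebra_simps)
      ultimately show ?thesis
        by (simp add: 0)
    next
      case (Suc r)
      \<comment> \<open>\<open>N\<close> is the index of the variable that multiplication by
        \<open>L\<close> on the right appends to \<open>lax_coeff p n r\<close>.\<close>
      define N where "N = int n - (int p + 1) * int r"
      have N: "int n - (int p + 1) * int q = N - int p - 1"
        "int (Suc n) - (int p + 1) * int q = N - int p"
        by (simp_all add: N_def Suc algebra_simps)
      have 1: "lax_coeff p (Suc n) q = lax_coeff p n q + lax_coeff p n r * u N"
        by (simp add: N_def Suc)
      have 2: "lax_coeff p (Suc n) (Suc q) = lax_coeff p n (Suc q) + lax_coeff p n q * u (N - int p - 1)"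
        using N(1) by simp
      have 3: "shift N (NIB p) = u N * (shift N a - shift (N - int p) a)"
        by (simp add: K)
      have 4: "shift (N - int p) a = shift (N - int p - 1) a + u N - u (N - int p - 1)"
        using a[of "N - int p - 1"] by simp
      have 5: "frechet (lax_coeff p n r) (NIB p) =
          shift (int p + 1) (lax_coeff p n q) - lax_coeff p n q + (a - shift N a) * lax_coeff p n r"
        using IH[of r] by (simp add: N_def Suc)
      have 6: "frechet (lax_coeff p n q) (NIB p) =
          shift (int p + 1) (lax_coeff p n (Suc q)) - lax_coeff p n (Suc q) +
          (a - shift (N - int p - 1) a) * lax_coeff p n q"
        using IH[of q] N(1) by simp
      have 7: "shift (int p + 1) (lax_coeff p n q * u (N - int p - 1)) =
          shift (int p + 1) (lax_coeff p n q) * u N"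
        by simp
      show ?thesis
        unfolding N(2) 1 2 frechet_add frechet_mult frechet_u 3 5 6 shift_add 7 4
        by (simp only: ring_distribs) algebra
    qed
  qed
qed

lemma is_symmetry_NIB_flow: "is_symmetry (NIB p) (NIB_flow p m :: 'a::field_char_0 dpoly)"
proof -
  define a :: "'a dpoly" where "a = (\<Sum>k=0..p. u (int k))"
  let ?K = "NIB p :: 'a dpoly" and ?Q = "NIB_flow p m :: 'a dpoly"
  define c :: "'a dpoly" where "c = lax_coeff p ((p + 1) * m) m"
  define c' :: "'a dpoly" where "c' = lax_coeff p ((p + 1) * m) (Suc m)"
  have K: "?K = u 0 * (a - shift (- int p) a)"
    unfolding NIB_eq_NIB_flow NIB_flow_1 a_def ..
  have Q: "?Q = u 0 * (c - shift (- int p) c)"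
    by (simp add: NIB_flow_def c_def)
  have Q': "?Q = shift 1 c' - c'"
    by (simp add: NIB_flow_eq_diff c'_def)
  \<comment> \<open>The derivative of \<open>a\<close> along the flow is a sum of its shifts, which
    telescopes.\<close>
  have "(\<Sum>k=0..n. shift (int k) (shift 1 c' - c')) = shift (int n + 1) c' - c'" for n
    by (induction n) (simp_all add: algebra_simps)
  then have a: "frechet a ?Q = shift (int p + 1) c' - c'"
    unfolding Q' by (simp add: a_def)
  \<comment> \<open>At \<open>\<S>\<^sup>0\<close> the commutator with \<open>a\<close> contributes
    \<open>a - shift 0 a = 0\<close>.\<close>
  have c: "frechet c ?K = shift (int p + 1) c' - c'"
    unfolding c_def c'_def frechet_lax_coeff by (simp add: algebra_simps)
  let ?d = "shift (int p + 1) c' - c'"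
  have "frechet ?Q ?K = ?K * (c - shift (- int p) c) + u 0 * (?d - shift (- int p) ?d)"
    by (subst Q) (simp only: frechet_mult frechet_u frechet_diff frechet_shift shift_0 c)
  moreover have "frechet ?K ?Q = ?Q * (a - shift (- int p) a) + u 0 * (?d - shift (- int p) ?d)"
    by (subst K) (simp only: frechet_mult frechet_u frechet_diff frechet_shift shift_0 a)
  \<comment> \<open>Both sides are \<open>u 0\<close> times the differences for \<open>a\<close> and
    \<open>c\<close>, so the terms from differentiating the prefactor \<open>u 0\<close>
    cancel.\<close>
  moreover have "?K * (c - shift (- int p) c) = ?Q * (a - shift (- int p) a)"
    unfolding K Q by (simp only: mult_ac)
  ultimately show ?thesis
    by (simp add: is_symmetry_def bracket_def)
qed

theorem theorem3:
  fixes p :: nat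
  assumes "p \<ge> 1"
  shows "\<forall>l::nat. \<exists>Q :: 'a::field_char_0 dpoly.
           op_power (rec_op p) l (NIB p) = Some Q \<and>
           is_symmetry (NIB p) Q \<and>
           Q = (let F = shift (1 - int l * int p) (hpoly p (l + 1) ((l + 1) * p - 1))
                in u 0 * (F - shift (- (int p + 1)) F))"
  using op_power_NIB[OF assms] is_symmetry_NIB_flow NIB_flow_eq_hpoly[OF assms] by blast

end
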